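(* Let $T$ be a tree of order $n$. (i) If $n\geq 2$ is even, then $RE(T)\leq \sqrt{(n-2)\frac{5n-10}{9}}+2$. (ii) If $n\geq 2$ is odd, then $RE(T)\leq \sqrt{(n-3)\frac{5n-10}{9}}+2$. (iii) If $n\geq 103$ is even, then $RE(T)\leq \sqrt{(n-2)\frac{15n-57}{28}}+2$. (iv) If $n\geq 103$ is odd, then $RE(T)\leq \sqrt{(n-3)\frac{15n-57}{28}}+2$.
   Context: Graphs are finite, simple and undirected. For a graph $G$ with vertex set $V$, edge set $E$ and vertex degrees $d_u$, the Randić matrix $R=[r_{uv}]$ is the real symmetric matrix indexed by $V$ with $r_{uv}=1/\sqrt{d_ud_v}$ if $uv\in E$ and $r_{uv}=0$ otherwise. The Randić energy is $RE(G)=\sum_{i=1}^n|\lambda_i|$, where $\lambda_1,\dots,\lambda_n$ are the eigenvalues of $R$ with multiplicity. *)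

theory Defs
  imports
    "Graph_Theory.Pair_Digraph"
    "Graph_Theory.Digraph_Component"
    "Jordan_Normal_Form.Char_Poly"
begin

text \<open>
  A finite simple undirected graph is a \<^locale>\<open>pair_graph\<close>: finite, loop-free, with a symmetric
  arc relation, so that an edge \<open>uv\<close> is the pair of arcs \<open>(u,v)\<close> and \<open>(v,u)\<close>.

  The constant \<open>tree\<close> of \<open>Digraph_Component\<close> cannot be used for such graphs: a single edge already
  gives the directed cycle \<open>u, v, u\<close>.  The cycles of the undirected graph are exactly the directed
  cycles of length at least 3.
\<close>

definition undirected_tree :: "'a pair_pre_digraph \<Rightarrow> bool" where
  "undirected_tree G \<longleftrightarrow>
     pair_graph G \<and> Digraph_Component.connected (with_proj G) \<and>
     \<not> (\<exists>p. pre_digraph.cycle (with_proj G) p \<and> 3 \<le> length p)"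

text \<open>In a symmetric digraph the out-degree is the degree of the undirected graph.\<close>

definition randic_entry :: "'a pair_pre_digraph \<Rightarrow> 'a \<Rightarrow> 'a \<Rightarrow> real" where
  "randic_entry G u v =
     (if (u, v) \<in> parcs G
      then 1 / sqrt (real (out_degree (with_proj G) u) * real (out_degree (with_proj G) v))
      else 0)"

text \<open>Matrices are indexed by \<open>{0..<n}\<close>, so the vertices are listed in some order \<open>vs\<close>.\<close>

definition randic_matrix :: "'a pair_pre_digraph \<Rightarrow> 'a list \<Rightarrow> real mat" where
  "randic_matrix G vs =
     mat (length vs) (length vs) (\<lambda>(i, j). randic_entry G (vs ! i) (vs ! j))"

text \<open>
  The sum of \<open>\<bar>\<lambda>\<bar>\<close> over the real eigenvalues with algebraic multiplicity.  It is only applied to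
  real symmetric matrices, all of whose eigenvalues are real.
\<close>

definition matrix_energy :: "real mat \<Rightarrow> real" where
  "matrix_energy A = (\<Sum>x\<in>#proots (char_poly A). \<bar>x\<bar>)"

text \<open>The value does not depend on the chosen order; see \<open>randic_energy_eq\<close> below.\<close>

definition randic_energy :: "'a pair_pre_digraph \<Rightarrow> real" where
  "randic_energy G =
     matrix_energy (randic_matrix G (SOME vs. distinct vs \<and> set vs = pverts G))"

lemma char_poly_reindex:
  fixes A B :: "'b :: field mat"
  assumes A: "A \<in> carrier_mat n n" and B: "B \<in> carrier_mat n n"
    and \<pi>: "bij_betw \<pi> {0..<n} {0..<n}"
    and AB: "\<And>i j. i < n \<Longrightarrow> j < n \<Longrightarrow> B $$ (i, j) = A $$ (\<pi> i, \<pi> j)"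
  shows "char_poly B = char_poly A"
proof -
  define P where "P = mat n n (\<lambda>(i, j). if \<pi> i = j then 1 else 0 :: 'b)"
  have P: "P \<in> carrier_mat n n" and PT: "transpose_mat P \<in> carrier_mat n n"
    by (auto simp: P_def)
  have \<pi>_less: "\<pi> i < n" if "i < n" for i
    using \<pi> that by (auto dest: bij_betwE)
  have \<pi>_eq: "\<pi> i = \<pi> j \<longleftrightarrow> i = j" if "i < n" "j < n" for i j
    using \<pi> that by (auto simp: bij_betw_def inj_on_def)
  have PPT: "P * transpose_mat P = 1\<^sub>m n"
  proof (rule eq_matI)
    fix i j assume "i < dim_row (1\<^sub>m n)" "j < dim_col (1\<^sub>m n)"
    then have ij: "i < n" "j < n" by auto
    have "(P * transpose_mat P) $$ (i, j)
        = (\<Sum>k = 0..<n. (if \<pi> i = k then 1 else 0) * (if \<pi> j = k then 1 else 0))"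
      using ij by (simp add: P_def scalar_prod_def)
    also have "\<dots> = (\<Sum>k = 0..<n. if \<pi> i = k then (if \<pi> j = \<pi> i then 1 else 0) else 0)"
      by (rule sum.cong) auto
    also have "\<dots> = 1\<^sub>m n $$ (i, j)"
      using ij \<pi>_less \<pi>_eq by auto
    finally show "(P * transpose_mat P) $$ (i, j) = 1\<^sub>m n $$ (i, j)" .
  qed (auto simp: P_def)
  have "P * A * transpose_mat P = B"
  proof (rule eq_matI)
    fix i j assume "i < dim_row B" "j < dim_col B"
    then have ij: "i < n" "j < n" using B by auto
    have PA: "(P * A) $$ (i, k) = A $$ (\<pi> i, k)" if k: "k < n" for k
    proof -
      have "(P * A) $$ (i, k) = (\<Sum>l = 0..<n. (if \<pi> i = l then 1 else 0) * A $$ (l, k))"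
        using ij k A by (simp add: P_def scalar_prod_def)
      also have "\<dots> = (\<Sum>l = 0..<n. if \<pi> i = l then A $$ (\<pi> i, k) else 0)"
        by (rule sum.cong) auto
      finally show ?thesis using ij \<pi>_less by auto
    qed
    have "(P * A * transpose_mat P) $$ (i, j)
        = (\<Sum>k = 0..<n. (P * A) $$ (i, k) * (if \<pi> j = k then 1 else 0))"
      using ij A by (simp add: P_def scalar_prod_def)
    also have "\<dots> = (\<Sum>k = 0..<n. if \<pi> j = k then A $$ (\<pi> i, \<pi> j) else 0)"
      by (rule sum.cong) (auto simp: PA)
    finally show "(P * A * transpose_mat P) $$ (i, j) = B $$ (i, j)"
      using ij \<pi>_less AB by auto
  qed (use A B in \<open>auto simp: P_def\<close>)
  then have "similar_mat_wit B A P (transpose_mat P)"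
    using A B P PT PPT mat_mult_left_right_inverse[OF P PT PPT]
    by (auto simp: similar_mat_wit_def Let_def)
  then show ?thesis
    by (intro char_poly_similar) (auto simp: similar_mat_def)
qed

lemma randic_energy_eq:
  assumes "distinct vs" and "set vs = pverts G"
  shows "randic_energy G = matrix_energy (randic_matrix G vs)"
proof -
  define ws where "ws = (SOME ws. distinct ws \<and> set ws = pverts G)"
  have "distinct ws \<and> set ws = pverts G"
    unfolding ws_def by (rule someI[of _ vs]) (use assms in auto)
  then have ws: "distinct ws" "set ws = set vs" using assms by auto
  define n where "n = length vs"
  have len: "length ws = n"
    using ws assms by (metis distinct_card n_def)
  have bv: "bij_betw ((!) vs) {0..<n} (set vs)" and bw: "bij_betw ((!) ws) {0..<n} (set vs)"
    using assms ws len by (auto intro!: bij_betw_nth simp: n_def)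
  define \<pi> where "\<pi> = inv_into {0..<n} ((!) vs) \<circ> (!) ws"
  have \<pi>: "bij_betw \<pi> {0..<n} {0..<n}"
    unfolding \<pi>_def by (rule bij_betw_trans[OF bw bij_betw_inv_into[OF bv]])
  have nth: "vs ! \<pi> i = ws ! i" if "i < n" for i
    using that bij_betw_inv_into_right[OF bv, of "ws ! i"] bij_betwE[OF bw]
    by (auto simp: \<pi>_def)
  have "\<pi> i < n" if "i < n" for i
    using \<pi> that by (auto dest: bij_betwE)
  then have "char_poly (randic_matrix G ws) = char_poly (randic_matrix G vs)"
    using nth by (intro char_poly_reindex[OF _ _ \<pi>]) (auto simp: randic_matrix_def n_def len)
  then show ?thesis
    by (simp add: randic_energy_def matrix_energy_def ws_def)
qed

end

theory Submission
  imports Defs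
begin

text \<open>
  Charge every edge of a rooted tree to one of its ends, so that the edges charged to a vertex \<open>x\<close> form
  a star.  The Randic matrix is then a sum of symmetrised dyads \<open>e\<^sub>x b\<^sub>x\<^sup>T + b\<^sub>x e\<^sub>x\<^sup>T\<close>, and its energy is at
  most the sum of the numbers \<open>2 |b\<^sub>x|\<close>, where \<open>|b\<^sub>x|\<^sup>2 = (\<Sum>u. 1 / d\<^sub>u) / d\<^sub>x\<close> over the leaves \<open>u\<close> of the star.
  By AM-GM \<open>2 |b\<^sub>x| \<le> ((\<Sum>u. 1 / d\<^sub>u) + 2 / d\<^sub>x) / sqrt 2\<close>.  If the stars come from a greedy vertex cover,
  these weights add up to at most \<open>n\<close>, apart from a correction at the root.  With a root of maximal
  degree this gives energy at most \<open>(n + 1 / 2) / sqrt 2\<close> for \<open>n \<ge> 3\<close>, and \<open>n / sqrt 2\<close> for odd \<open>n\<close>.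
  Since \<open>1 / sqrt 2 < sqrt 5 / 3\<close> and \<open>1 / sqrt 2 < sqrt (15 / 28)\<close>, this is stronger than the four
  claims, except for \<open>n \<le> 3\<close>, where the tree is a star of energy 2.  In particular, no bound on the
  index \<open>R\<^sub>-\<^sub>1\<close> is needed.
\<close>

section \<open>The energy of a sum of dyads\<close>

text \<open>The reflection swapping the first unit vector and \<open>v\<close> is symmetric and its
  own inverse. Conjugating by it moves an eigenvector \<open>v\<close> into the first
  coordinate.\<close>

lemma householder_exists:
  fixes v :: "real vec"
  assumes v: "v \<in> carrier_vec (Suc m)" and v1: "v \<bullet> v = 1"
  obtains Q where "Q \<in> carrier_mat (Suc m) (Suc m)" "transpose_mat Q = Q"
    "Q * Q = 1\<^sub>m (Suc m)" "col Q 0 = v"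
proof (cases "v $ 0 = 1")
  \<comment> \<open>A unit vector with first coordinate 1 is the first unit vector. The normal of
    the mirror vanishes here, so the identity replaces the reflection.\<close>
  case True
  have "v \<bullet> v = (v $ 0)\<^sup>2 + (\<Sum>i = 1..<Suc m. (v $ i)\<^sup>2)"
    using v by (simp add: scalar_prod_def power2_eq_square sum.atLeast_Suc_lessThan)
  with True v1 have "(\<Sum>i = 1..<Suc m. (v $ i)\<^sup>2) = 0" by simp
  then have "v $ i = 0" if "i \<in> {1..<Suc m}" for i
    using that by (subst (asm) sum_nonneg_eq_0_iff) auto
  with True have "col (1\<^sub>m (Suc m)) 0 = v"
    using v by (intro eq_vecI) auto
  then show ?thesis by (intro that[of "1\<^sub>m (Suc m)"]) auto
next
  case False
  \<comment> \<open>the reflection in the hyperplane orthogonal to \<open>v - e\<^sub>0\<close>\<close>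
  define w where "w i = v $ i - (if i = 0 then 1 else 0)" for i
  \<comment> \<open>\<open>t\<close> equals \<open>2 / |w|^2\<close>, since
    \<open>|w|^2 = 2 - 2 * v $ 0\<close>.\<close>
  define t where "t = 1 / (1 - v $ 0)"
  define Q where "Q = mat (Suc m) (Suc m) (\<lambda>(i, j). (if i = j then 1 else 0) - t * w i * w j)"
  have Q: "Q \<in> carrier_mat (Suc m) (Suc m)" by (simp add: Q_def)
  have sumw: "(\<Sum>i = 0..<Suc m. w i * w i) = 2 - 2 * v $ 0"
  proof -
    have "(\<Sum>i = 0..<Suc m. w i * w i)
        = (\<Sum>i = 0..<Suc m. v $ i * v $ i + (if i = 0 then 1 - 2 * v $ 0 else 0))"
      by (rule sum.cong) (auto simp: w_def algebra_simps)
    also have "\<dots> = v \<bullet> v + (1 - 2 * v $ 0)"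
      using v by (simp add: sum.distrib scalar_prod_def del: sum.op_ivl_Suc)
    finally show ?thesis using v1 by simp
  qed
  have tw: "t * (2 - 2 * v $ 0) = 2"
    using False by (simp add: t_def field_simps)
  have "Q * Q = 1\<^sub>m (Suc m)"
  proof (rule eq_matI)
    fix i j assume "i < dim_row (1\<^sub>m (Suc m))" "j < dim_col (1\<^sub>m (Suc m))"
    then have ij: "i < Suc m" "j < Suc m" by auto
    have "(Q * Q) $$ (i, j) = (\<Sum>k = 0..<Suc m.
        ((if i = k then 1 else 0) - t * w i * w k) * ((if k = j then 1 else 0) - t * w k * w j))"
      using ij by (simp add: Q_def scalar_prod_def del: sum.op_ivl_Suc)
    also have "\<dots> = (\<Sum>k = 0..<Suc m. (if i = k then (if i = j then 1 else 0) else 0)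
        + (if i = k then - t * w i * w j else 0) + (if k = j then - t * w i * w j else 0)
        + t * t * w i * w j * (w k * w k))"
      by (rule sum.cong) (auto simp: algebra_simps)
    also have "\<dots> = (if i = j then 1 else 0) - 2 * t * w i * w j
        + t * t * w i * w j * (2 - 2 * v $ 0)"
      using ij by (simp add: sum.distrib sum_distrib_left[symmetric] sumw del: sum.op_ivl_Suc)
    also have "t * t * w i * w j * (2 - 2 * v $ 0) = t * w i * w j * (t * (2 - 2 * v $ 0))"
      by (simp add: algebra_simps)
    finally show "(Q * Q) $$ (i, j) = 1\<^sub>m (Suc m) $$ (i, j)"
      using ij unfolding tw by simp
  qed (auto simp: Q_def)
  moreover have "transpose_mat Q = Q"
    by (rule eq_matI) (auto simp: Q_def)
  moreover have "col Q 0 = v"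
  proof (rule eq_vecI)
    fix i assume "i < dim_vec v"
    then have i: "i < Suc m" using v by simp
    have "t * w 0 = -1" using False by (simp add: t_def w_def field_simps)
    then have "t * w i * w 0 = - w i" by (metis mult.commute mult.left_commute mult_minus1)
    then show "col Q 0 $ i = v $ i"
      using i by (simp add: Q_def) (simp add: w_def)
  qed (use v in \<open>simp add: Q_def\<close>)
  ultimately show ?thesis using that Q by blast
qed

text \<open>The entries of a conjugate \<open>Q * A * Q\<close> are values of this bilinear form, so
  conjugation keeps the dyadic shape and transforms each dyad separately.\<close>

lemma scalar_prod_dyadic:
  fixes A :: "real mat"
  assumes A: "A \<in> carrier_mat n n" and x: "x \<in> carrier_vec n" and y: "y \<in> carrier_vec n"
    and a: "\<And>k. k \<in> K \<Longrightarrow> a k \<in> carrier_vec n" and b: "\<And>k. k \<in> K \<Longrightarrow> b k \<in> carrier_vec n"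
    and eq: "\<And>i j. i < n \<Longrightarrow> j < n \<Longrightarrow>
      A $$ (i, j) = (\<Sum>k\<in>K. a k $ i * b k $ j + b k $ i * a k $ j)"
  shows "x \<bullet> (A *\<^sub>v y) = (\<Sum>k\<in>K. (x \<bullet> a k) * (b k \<bullet> y) + (x \<bullet> b k) * (a k \<bullet> y))"
proof -
  have "x \<bullet> (A *\<^sub>v y) = (\<Sum>i = 0..<n. \<Sum>j = 0..<n. x $ i * (A $$ (i, j) * y $ j))"
    using A x y by (simp add: scalar_prod_def sum_distrib_left)
  also have "\<dots> = (\<Sum>i = 0..<n. \<Sum>j = 0..<n. \<Sum>k\<in>K.
      (x $ i * a k $ i) * (b k $ j * y $ j) + (x $ i * b k $ i) * (a k $ j * y $ j))"
    by (intro sum.cong refl) (auto simp: eq sum_distrib_left sum_distrib_right algebra_simps)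
  also have "\<dots> = (\<Sum>i = 0..<n. \<Sum>k\<in>K. \<Sum>j = 0..<n.
      (x $ i * a k $ i) * (b k $ j * y $ j) + (x $ i * b k $ i) * (a k $ j * y $ j))"
    by (intro sum.cong refl sum.swap)
  also have "\<dots> = (\<Sum>k\<in>K. \<Sum>i = 0..<n. \<Sum>j = 0..<n.
      (x $ i * a k $ i) * (b k $ j * y $ j) + (x $ i * b k $ i) * (a k $ j * y $ j))"
    by (rule sum.swap)
  also have "\<dots> = (\<Sum>k\<in>K. (x \<bullet> a k) * (b k \<bullet> y) + (x \<bullet> b k) * (a k \<bullet> y))"
  proof (intro sum.cong refl)
    fix k assume k: "k \<in> K"
    show "(\<Sum>i = 0..<n. \<Sum>j = 0..<n.
      (x $ i * a k $ i) * (b k $ j * y $ j) + (x $ i * b k $ i) * (a k $ j * y $ j))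
      = (x \<bullet> a k) * (b k \<bullet> y) + (x \<bullet> b k) * (a k \<bullet> y)"
      using a[OF k] b[OF k] x y by (simp add: scalar_prod_def sum.distrib sum_product)
  qed
  finally show ?thesis .
qed

text \<open>Cauchy-Schwarz for the plane vectors \<open>(\<bar>x\<bar>, sqrt p)\<close> and
  \<open>(\<bar>y\<bar>, sqrt q)\<close>. The difference of the squares is the square of their
  determinant.\<close>

lemma cauchy_schwarz_two:
  fixes x y :: real
  assumes "0 \<le> p" "0 \<le> q"
  shows "\<bar>x * y\<bar> + sqrt p * sqrt q \<le> sqrt (x\<^sup>2 + p) * sqrt (y\<^sup>2 + q)"
proof -
  have "(\<bar>x * y\<bar> + sqrt p * sqrt q)\<^sup>2 \<le> (x\<^sup>2 + p) * (y\<^sup>2 + q)"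
  proof -
    have "0 \<le> (\<bar>x\<bar> * sqrt q - \<bar>y\<bar> * sqrt p)\<^sup>2" by simp
    moreover have "(x\<^sup>2 + p) * (y\<^sup>2 + q) - (\<bar>x * y\<bar> + sqrt p * sqrt q)\<^sup>2
        = (\<bar>x\<bar> * sqrt q - \<bar>y\<bar> * sqrt p)\<^sup>2"
      using assms by (simp add: power2_sum power2_diff power_mult_distrib abs_mult algebra_simps)
    ultimately show ?thesis by linarith
  qed
  then show ?thesis using assms by (simp add: real_le_rsqrt real_sqrt_mult[symmetric])
qed

text \<open>
  Deflation: conjugating by a reflection splits off one eigenvalue, each dyad loses its first
  coordinates, and Cauchy-Schwarz in the plane pays for both parts.  Eigenvalues are only removed
  while the characteristic polynomial has a real root, so no spectral theorem is needed.
\<close>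

lemma matrix_energy_dyadic_le:
  fixes A :: "real mat" and a b :: "'k \<Rightarrow> real vec"
  assumes "A \<in> carrier_mat n n"
    and "\<And>k. k \<in> K \<Longrightarrow> a k \<in> carrier_vec n" and "\<And>k. k \<in> K \<Longrightarrow> b k \<in> carrier_vec n"
    and "\<And>i j. i < n \<Longrightarrow> j < n \<Longrightarrow>
      A $$ (i, j) = (\<Sum>k\<in>K. a k $ i * b k $ j + b k $ i * a k $ j)"
  shows "matrix_energy A \<le> (\<Sum>k\<in>K. 2 * (sqrt (a k \<bullet> a k) * sqrt (b k \<bullet> b k)))"
  using assms
proof (induction n arbitrary: A a b)
  case 0
  then have "char_poly A = 1" by (simp add: char_poly_def)
  moreover have "0 \<le> (\<Sum>k\<in>K. 2 * (sqrt (a k \<bullet> a k) * sqrt (b k \<bullet> b k)))"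
    by (intro sum_nonneg mult_nonneg_nonneg) (auto simp: scalar_prod_def intro!: sum_nonneg)
  ultimately show ?case by (simp add: matrix_energy_def)
next
  case (Suc m)
  note A = Suc.prems(1) and a = Suc.prems(2) and b = Suc.prems(3) and eq = Suc.prems(4)
  have cp0: "char_poly A \<noteq> 0" using degree_monic_char_poly[OF A] by auto
  have nonneg: "0 \<le> (x :: real vec) \<bullet> x" for x by (auto simp: scalar_prod_def intro!: sum_nonneg)
  show ?case
  proof (cases "proots (char_poly A) = {#}")
    case True
    then have "matrix_energy A = 0" by (simp add: matrix_energy_def)
    then show ?thesis using nonneg by (auto intro!: sum_nonneg mult_nonneg_nonneg)
  next
    case False
    then obtain l where "l \<in># proots (char_poly A)" by blast
    then have "poly (char_poly A) l = 0" using cp0 by simp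
    then have "eigenvalue A l" using eigenvalue_root_char_poly[OF A] by simp
    then obtain u where u: "u \<in> carrier_vec (Suc m)" "u \<noteq> 0\<^sub>v (Suc m)" "A *\<^sub>v u = l \<cdot>\<^sub>v u"
      using A by (auto simp: eigenvalue_def eigenvector_def)
    have "u \<bullet> u > 0"
    proof -
      have "u \<bullet> u \<noteq> 0"
        using u conjugate_square_eq_0_vec[of u "Suc m"] by (auto simp: conjugate_vec_def)
      then show ?thesis using nonneg[of u] by linarith
    qed
    define v where "v = (1 / sqrt (u \<bullet> u)) \<cdot>\<^sub>v u"
    have v: "v \<in> carrier_vec (Suc m)" using u by (simp add: v_def)
    have v1: "v \<bullet> v = 1" using u \<open>u \<bullet> u > 0\<close> by (simp add: v_def)
    have Av: "A *\<^sub>v v = l \<cdot>\<^sub>v v"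
      using A u by (simp add: v_def mult_mat_vec smult_smult_assoc mult.commute)
    obtain Q where Q: "Q \<in> carrier_mat (Suc m) (Suc m)" and QT: "transpose_mat Q = Q"
      and QQ: "Q * Q = 1\<^sub>m (Suc m)" and Q0: "col Q 0 = v"
      using householder_exists[OF v v1] by blast
    define B where "B = Q * A * Q"
    have B: "B \<in> carrier_mat (Suc m) (Suc m)" using A Q by (simp add: B_def)
    define a' where "a' k = Q *\<^sub>v a k" for k
    define b' where "b' k = Q *\<^sub>v b k" for k
    have rowQ: "row Q i = col Q i" if "i < Suc m" for i
      using QT Q that by (metis carrier_matD(2) row_transpose)
    have norm: "(Q *\<^sub>v x) \<bullet> (Q *\<^sub>v x) = x \<bullet> x" if x: "x \<in> carrier_vec (Suc m)" for x
    proof -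
      have "(Q *\<^sub>v x) \<bullet> (Q *\<^sub>v x) = (transpose_mat Q *\<^sub>v (Q *\<^sub>v x)) \<bullet> x"
        using Q x by (intro transpose_vec_mult_scalar[symmetric]) auto
      also have "transpose_mat Q *\<^sub>v (Q *\<^sub>v x) = x"
        using Q x QQ by (simp add: QT assoc_mult_mat_vec[symmetric])
      finally show ?thesis .
    qed
    have Beq: "B $$ (i, j) = (\<Sum>k\<in>K. a' k $ i * b' k $ j + b' k $ i * a' k $ j)"
      if ij: "i < Suc m" "j < Suc m" for i j
    proof -
      have "B $$ (i, j) = row Q i \<bullet> (A *\<^sub>v col Q j)"
        using A Q ij by (simp add: B_def assoc_mult_mat[OF Q A Q] mult_mat_vec_def)
      also have "\<dots> = (\<Sum>k\<in>K. (row Q i \<bullet> a k) * (b k \<bullet> col Q j) + (row Q i \<bullet> b k) * (a k \<bullet> col Q j))"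
        by (rule scalar_prod_dyadic[OF A row_carrier_vec[OF ij(1) Q] col_carrier_vec[OF ij(2) Q] a b eq])
      also have "\<dots> = (\<Sum>k\<in>K. a' k $ i * b' k $ j + b' k $ i * a' k $ j)"
        using Q ij a b
        by (intro sum.cong refl) (simp add: a'_def b'_def rowQ comm_scalar_prod[of _ "Suc m"])
      finally show ?thesis .
    qed
    \<comment> \<open>\<open>Q\<close> maps \<open>v\<close> back to the first unit vector. Hence
      the first column of \<open>B\<close> is \<open>l\<close> times that vector, and
      \<open>B\<close> is block upper triangular.\<close>
    have Qv: "Q *\<^sub>v v = col (1\<^sub>m (Suc m)) 0"
      using col_mult2[OF Q Q, of 0] by (simp add: QQ Q0)
    have "col B 0 = Q *\<^sub>v (A *\<^sub>v v)"
      using col_mult2[OF Q mult_carrier_mat[OF A Q], of 0] col_mult2[OF A Q, of 0]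
      by (simp add: B_def assoc_mult_mat[OF Q A Q] Q0)
    also have "\<dots> = l \<cdot>\<^sub>v col (1\<^sub>m (Suc m)) 0"
      using Q v by (simp add: Av mult_mat_vec Qv)
    finally have colB: "col B 0 = l \<cdot>\<^sub>v col (1\<^sub>m (Suc m)) 0" .
    have B0: "B $$ (i, 0) = (if i = 0 then l else 0)" if "i < Suc m" for i
      using arg_cong[OF colB, of "\<lambda>x. x $ i"] that B by simp
    define D where "D = mat m m (\<lambda>(i, j). B $$ (Suc i, Suc j))"
    have D: "D \<in> carrier_mat m m" by (simp add: D_def)
    define L where "L = mat 1 1 (\<lambda>_. l)"
    define R where "R = mat 1 m (\<lambda>(i, j). B $$ (0, Suc j))"
    have Bblock: "B = four_block_mat L R (0\<^sub>m m 1) D"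
      by (rule eq_matI) (use B B0 in \<open>auto simp: D_def L_def R_def\<close>)
    have "similar_mat_wit B A Q Q"
      using A Q B QQ by (simp add: similar_mat_wit_def Let_def B_def)
    then have "char_poly A = char_poly B"
      by (metis char_poly_similar similar_mat_def)
    also have "\<dots> = char_poly L * char_poly D"
      unfolding Bblock by (rule char_poly_four_block_zeros_col) (auto simp: L_def R_def D)
    also have "char_poly L = [:- l, 1:]"
      by (subst char_poly_upper_triangular[of _ 1]) (auto simp: L_def diag_mat_def)
    finally have "char_poly A = [:- l, 1:] * char_poly D" .
    moreover have "char_poly D \<noteq> 0" using degree_monic_char_poly[OF D] by auto
    then have "proots ([:- l, 1:] * char_poly D) = proots [:- l, 1:] + proots (char_poly D)"
      by (intro proots_mult) auto
    ultimately have energy: "matrix_energy A = \<bar>l\<bar> + matrix_energy D"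
      by (simp add: matrix_energy_def)
    \<comment> \<open>Deleting coordinate 0 from the transformed dyads leaves the dyads of the block
      \<open>D\<close>.\<close>
    define ar where "ar k = vec m (\<lambda>i. a' k $ Suc i)" for k
    define br where "br k = vec m (\<lambda>i. b' k $ Suc i)" for k
    have "matrix_energy D \<le> (\<Sum>k\<in>K. 2 * (sqrt (ar k \<bullet> ar k) * sqrt (br k \<bullet> br k)))"
      by (rule Suc.IH[OF D]) (auto simp: D_def Beq ar_def br_def)
    \<comment> \<open>\<open>l\<close> is the corner entry of \<open>B\<close>, where the two halves
      of each dyad coincide.\<close>
    moreover have "\<bar>l\<bar> \<le> (\<Sum>k\<in>K. 2 * \<bar>a' k $ 0 * b' k $ 0\<bar>)"
    proof -
      have "l = (\<Sum>k\<in>K. 2 * (a' k $ 0 * b' k $ 0))"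
        by (simp only: B0[of 0, simplified, symmetric] Beq[of 0 0, simplified])
      then have "\<bar>l\<bar> \<le> (\<Sum>k\<in>K. \<bar>2 * (a' k $ 0 * b' k $ 0)\<bar>)" by (metis sum_abs)
      then show ?thesis by (simp only: abs_mult abs_numeral)
    qed
    moreover have "\<bar>a' k $ 0 * b' k $ 0\<bar> + sqrt (ar k \<bullet> ar k) * sqrt (br k \<bullet> br k)
        \<le> sqrt (a k \<bullet> a k) * sqrt (b k \<bullet> b k)" if k: "k \<in> K" for k
    proof -
      have "a k \<bullet> a k = a' k \<bullet> a' k" "b k \<bullet> b k = b' k \<bullet> b' k"
        using norm a[OF k] b[OF k] by (auto simp: a'_def b'_def)
      moreover have "a' k \<bullet> a' k = (a' k $ 0)\<^sup>2 + ar k \<bullet> ar k"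
        using Q unfolding a'_def ar_def
        by (simp add: scalar_prod_def power2_eq_square sum.atLeast0_lessThan_Suc_shift del: sum.op_ivl_Suc)
      moreover have "b' k \<bullet> b' k = (b' k $ 0)\<^sup>2 + br k \<bullet> br k"
        using Q unfolding b'_def br_def
        by (simp add: scalar_prod_def power2_eq_square sum.atLeast0_lessThan_Suc_shift del: sum.op_ivl_Suc)
      ultimately have "a k \<bullet> a k = (a' k $ 0)\<^sup>2 + ar k \<bullet> ar k"
          "b k \<bullet> b k = (b' k $ 0)\<^sup>2 + br k \<bullet> br k"
        by presburger+
      then show ?thesis by (simp only: cauchy_schwarz_two nonneg)
    qed
    then have "(\<Sum>k\<in>K. 2 * (\<bar>a' k $ 0 * b' k $ 0\<bar> + sqrt (ar k \<bullet> ar k) * sqrt (br k \<bullet> br k)))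
        \<le> (\<Sum>k\<in>K. 2 * (sqrt (a k \<bullet> a k) * sqrt (b k \<bullet> b k)))"
      by (intro sum_mono mult_left_mono) auto
    moreover have "(\<Sum>k\<in>K. 2 * (\<bar>a' k $ 0 * b' k $ 0\<bar> + sqrt (ar k \<bullet> ar k) * sqrt (br k \<bullet> br k)))
        = (\<Sum>k\<in>K. 2 * \<bar>a' k $ 0 * b' k $ 0\<bar>)
          + (\<Sum>k\<in>K. 2 * (sqrt (ar k \<bullet> ar k) * sqrt (br k \<bullet> br k)))"
      unfolding distrib_left by (rule sum.distrib)
    ultimately show ?thesis
      unfolding energy by linarith
  qed
qed

section \<open>Star covers of rooted trees\<close>

text \<open>Membership of \<open>x\<close> is decided by its predecessors, so well-founded recursion
  defines \<open>C\<close>. Its complement is a kernel of the relation.\<close>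

lemma wf_kernel_exists:
  assumes "wf R"
  shows "\<exists>C. \<forall>x. x \<in> C \<longleftrightarrow> (\<exists>u. (u, x) \<in> R \<and> u \<notin> C)"
proof -
  define F where "F f x \<longleftrightarrow> (\<exists>u. (u, x) \<in> R \<and> \<not> f u)" for f x
  \<comment> \<open>\<open>F\<close> reads its argument only at predecessors of \<open>x\<close>,
    where \<open>cut\<close> leaves the values unchanged.\<close>
  have "wfrec R F x \<longleftrightarrow> (\<exists>u. (u, x) \<in> R \<and> \<not> wfrec R F u)" for x
    using wfrec[OF assms, of F x] unfolding F_def cut_def by (simp cong: conj_cong)
  then show ?thesis by (intro exI[of _ "Collect (wfrec R F)"]) blast
qed

text \<open>\<open>dep\<close> is any potential that drops from a vertex to its parent, not
  necessarily the distance to \<open>r\<close>. As in \<open>parcs\<close>, an edge appears in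
  \<open>E\<close> in both directions.\<close>

locale rooted_tree =
  fixes V :: "'a set" and E :: "'a rel" and r :: 'a and par :: "'a \<Rightarrow> 'a" and dep :: "'a \<Rightarrow> nat"
  assumes finite_V: "finite V" and root_in: "r \<in> V"
    and par_in: "u \<in> V \<Longrightarrow> u \<noteq> r \<Longrightarrow> par u \<in> V"
    and dep_par: "u \<in> V \<Longrightarrow> u \<noteq> r \<Longrightarrow> dep (par u) < dep u"
    and edge_iff: "(u, v) \<in> E \<longleftrightarrow> (u \<in> V \<and> u \<noteq> r \<and> v = par u) \<or> (v \<in> V \<and> v \<noteq> r \<and> u = par v)"
begin

section \<open>Children, parents and degrees in a rooted tree\<close>

definition children :: "'a \<Rightarrow> 'a set" where
  "children x = {u \<in> V. u \<noteq> r \<and> par u = x}"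

text \<open>Set-valued, so that the arbitrary value \<open>par r\<close> never enters.\<close>

definition up :: "'a \<Rightarrow> 'a set" where
  "up x = (if x = r then {} else {par x})"

definition deg :: "'a \<Rightarrow> nat" where
  "deg x = card {u. (x, u) \<in> E}"

lemma finite_children [simp]: "finite (children x)"
  using finite_V by (simp add: children_def)

lemma finite_up [simp]: "finite (up x)" by (simp add: up_def)

lemma neighbours_eq: "x \<in> V \<Longrightarrow> {u. (x, u) \<in> E} = children x \<union> up x"
  by (auto simp: edge_iff children_def up_def)

lemma children_up_disjoint: "x \<in> V \<Longrightarrow> children x \<inter> up x = {}"
  using dep_par[of x] dep_par[of "par x"] by (auto simp: children_def up_def)

lemma deg_eq: "x \<in> V \<Longrightarrow> deg x = card (children x) + (if x = r then 0 else 1)"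
  by (simp add: deg_def neighbours_eq card_Un_disjoint children_up_disjoint) (simp add: up_def)

lemma sum_card_children: "(\<Sum>x\<in>V. card (children x)) = card V - 1"
proof -
  have "(\<Sum>x\<in>V. card (children x)) = card (\<Union>x\<in>V. children x)"
    using finite_V by (intro card_UN_disjoint[symmetric]) (auto simp: children_def)
  also have "(\<Union>x\<in>V. children x) = V - {r}"
    using par_in by (auto simp: children_def)
  finally show ?thesis using root_in by simp
qed

lemma sum_deg: "(\<Sum>x\<in>V. deg x) = 2 * (card V - 1)"
proof -
  have "(\<Sum>x\<in>V. deg x) = (\<Sum>x\<in>V. card (children x)) + (\<Sum>x\<in>V. if x = r then 0 else 1)"
    by (simp add: deg_eq sum.distrib)
  also have "(\<Sum>x\<in>V. if x = r then 0 else 1) = card (V - {r})"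
    using finite_V by (simp add: sum.If_cases Diff_eq Compl_eq Int_commute)
  finally show ?thesis using root_in by (simp add: sum_card_children)
qed

lemma children_root_nonempty:
  assumes "card V \<ge> 2"
  shows "children r \<noteq> {}"
proof -
  have "V \<noteq> {r}" using assms by auto
  then obtain w where "w \<in> V - {r}" using root_in by blast
  \<comment> \<open>A non-root vertex of least depth: its parent is strictly less deep, hence is the
    root.\<close>
  then obtain u where u: "u \<in> V - {r}" "\<And>v. v \<in> V - {r} \<Longrightarrow> dep u \<le> dep v"
    using ex_has_least_nat[of "\<lambda>u. u \<in> V - {r}" w dep] by blast
  then have "par u = r" using par_in[of u] dep_par[of u] by force
  then show ?thesis using u by (auto simp: children_def)
qed

lemma deg_pos: "card V \<ge> 2 \<Longrightarrow> x \<in> V \<Longrightarrow> deg x > 0"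
  using children_root_nonempty by (auto simp: deg_eq card_gt_0_iff)

text \<open>
  The greedy vertex cover taken from the leaves upwards.  An edge is charged to its lower end if that
  end is in the cover, and to its upper end otherwise.
\<close>

definition cover :: "'a set" where
  "cover = (SOME C. \<forall>x. x \<in> C \<longleftrightarrow> (\<exists>u\<in>children x. u \<notin> C))"

lemma cover_iff: "x \<in> cover \<longleftrightarrow> (\<exists>u\<in>children x. u \<notin> cover)"
proof -
  \<comment> \<open>The recursion runs from children to parents while \<open>dep\<close> grows
    downwards, so \<open>dep\<close> is subtracted from an upper bound, the sum of all
    depths.\<close>
  have "{(u, x). u \<in> children x} \<subseteq> measure (\<lambda>x. Suc (\<Sum>u\<in>V. dep u) - dep x)"
  proof clarify
    fix u x assume "u \<in> children x"
    then have u: "u \<in> V" "u \<noteq> r" "par u = x" by (auto simp: children_def)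
    have "dep u \<le> (\<Sum>u\<in>V. dep u)" using u finite_V by (intro member_le_sum) auto
    then show "(u, x) \<in> measure (\<lambda>x. Suc (\<Sum>u\<in>V. dep u) - dep x)"
      using dep_par[OF u(1,2)] u(3) by simp
  qed
  then have "wf {(u, x). u \<in> children x}" by (rule wf_subset[OF wf_measure])
  from wf_kernel_exists[OF this] have "\<exists>C. \<forall>x. x \<in> C \<longleftrightarrow> (\<exists>u\<in>children x. u \<notin> C)"
    unfolding Bex_def mem_Collect_eq case_prod_conv .
  then have "\<forall>x. x \<in> cover \<longleftrightarrow> (\<exists>u\<in>children x. u \<notin> cover)"
    unfolding cover_def by (rule someI_ex)
  then show ?thesis by (rule spec)
qed

lemma cover_subset: "cover \<subseteq> V"
proof
  fix x assume "x \<in> cover"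
  then obtain u where "u \<in> children x" using cover_iff[of x] by blast
  then show "x \<in> V" using par_in by (auto simp: children_def)
qed

lemma finite_cover [simp]: "finite cover"
  using cover_subset finite_V by (rule finite_subset)

lemma par_in_cover: "u \<in> V \<Longrightarrow> u \<noteq> r \<Longrightarrow> u \<notin> cover \<Longrightarrow> par u \<in> cover"
  by (subst cover_iff) (auto simp: children_def)

lemma children_subset_cover: "u \<notin> cover \<Longrightarrow> children u \<subseteq> cover"
  using cover_iff[of u] by blast

text \<open>For \<open>x\<close> in the cover these are the far ends of the edges charged to
  \<open>x\<close>: the edge to its parent and the edges to uncovered children.\<close>

definition star :: "'a \<Rightarrow> 'a set" where
  "star x = (children x - cover) \<union> up x"

lemma star_subset: "x \<in> V \<Longrightarrow> star x \<subseteq> V"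
  using par_in by (auto simp: star_def children_def up_def)

lemma finite_star [simp]: "finite (star x)" by (simp add: star_def)

lemma sum_star:
  fixes f :: "'a \<Rightarrow> real"
  assumes "x \<in> V"
  shows "(\<Sum>u\<in>V. if u \<in> star x then f u else 0) = (\<Sum>u\<in>star x. f u)"
  using sum.inter_restrict[OF finite_V, of f "star x"] star_subset[OF assms] by (simp add: Int_absorb1)

text \<open>The edge from a vertex to its parent lies in the star of the lower end if that end is
  covered; otherwise \<open>par_in_cover\<close> puts the upper end in the cover and the edge in its
  star.\<close>

lemma edge_iff_star:
  "(u, v) \<in> E \<longleftrightarrow> (u \<in> cover \<and> v \<in> star u) \<or> (v \<in> cover \<and> u \<in> star v)"
  using cover_subset cover_iff[of u] cover_iff[of v]
  by (auto simp: edge_iff star_def children_def up_def split: if_splits)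

text \<open>An edge with two covered ends lies only in the star of its lower end, and depth tells
  the ends apart. So no edge is charged twice.\<close>

lemma star_asym: "u \<in> cover \<Longrightarrow> v \<in> star u \<Longrightarrow> v \<in> cover \<Longrightarrow> u \<notin> star v"
  using dep_par[of u] dep_par[of v] cover_subset[THEN subsetD, of u] cover_subset[THEN subsetD, of v]
  by (auto simp: star_def children_def up_def split: if_splits)

text \<open>A covered vertex has at least one uncovered child; this counts the further ones, so the
  truncated subtraction is exact on the cover.\<close>

definition excess :: "'a \<Rightarrow> nat" where
  "excess x = card (children x - cover) - 1"

lemma card_children_minus_cover: "x \<in> cover \<Longrightarrow> card (children x - cover) = Suc (excess x)"
proof -
  assume "x \<in> cover"
  then have "children x - cover \<noteq> {}" using cover_iff[of x] by blast
  then have "card (children x - cover) > 0" by (simp add: card_gt_0_iff)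
  then show ?thesis by (simp add: excess_def)
qed

text \<open>Each uncovered vertex other than the root is an uncovered child of exactly one covered
  vertex, its parent.\<close>

lemma sum_excess: "(\<Sum>x\<in>cover. Suc (excess x)) = card (V - cover - {r})"
proof -
  have "(\<Sum>x\<in>cover. Suc (excess x)) = (\<Sum>x\<in>cover. card (children x - cover))"
    by (simp add: card_children_minus_cover)
  also have "\<dots> = card (\<Union>x\<in>cover. children x - cover)"
    using finite_V by (intro card_UN_disjoint[symmetric]) (auto simp: children_def)
  also have "(\<Union>x\<in>cover. children x - cover) = V - cover - {r}"
    using par_in_cover by (auto simp: children_def)
  finally show ?thesis .
qed

text \<open>
  Double counting: a vertex outside the cover lies in the stars of all its neighbours, so it receives
  total weight 1; a vertex of the cover only lies in the stars of its children in the cover.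
\<close>

lemma star_weight_eq:
  assumes n: "card V \<ge> 2"
  shows "(\<Sum>x\<in>cover. (\<Sum>u\<in>star x. 1 / real (deg u)) + 2 / real (deg x))
    = real (card V) - (\<Sum>x\<in>cover. real (excess x) / real (deg x))
      + (if r \<in> cover then 1 / real (deg r) else 0)"
proof -
  define j where "j x = card (children x \<inter> cover)" for x
  \<comment> \<open>The degree splits into \<open>j x\<close> covered children,
    \<open>Suc (excess x)\<close> uncovered children, and the parent unless \<open>x\<close> is the
    root.\<close>
  have deg: "real (j x) + 1 = real (deg x) - real (excess x) - (if x = r then 0 else 1)"
    if x: "x \<in> cover" for x
  proof -
    have "card (children x) = j x + card (children x - cover)"
      unfolding j_def by (metis Diff_Int_distrib2 card_Int_Diff finite_children)
    then show ?thesis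
      using x cover_subset card_children_minus_cover[OF x] deg_eq[of x] by auto
  qed
  have count: "card {x \<in> cover. u \<in> star x} = (if u \<in> cover then j u else deg u)" if u: "u \<in> V" for u
  proof (cases "u \<in> cover")
    case True
    then have "{x \<in> cover. u \<in> star x} = children u \<inter> cover"
      using cover_subset by (auto simp: star_def children_def up_def split: if_splits)
    with True show ?thesis by (simp add: j_def)
  next
    case False
    then have "{x \<in> cover. u \<in> star x} = children u \<union> up u"
      using cover_subset children_subset_cover[of u] par_in_cover[of u] u
      by (auto simp: star_def children_def up_def split: if_splits)
    with False u show ?thesis by (simp add: deg_def neighbours_eq)
  qed
  have "(\<Sum>x\<in>cover. \<Sum>u\<in>star x. 1 / real (deg u))
      = (\<Sum>x\<in>cover. \<Sum>u\<in>V. if u \<in> star x then 1 / real (deg u) else 0)"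
    using cover_subset by (intro sum.cong[OF refl]) (simp add: sum_star subset_iff)
  also have "\<dots> = (\<Sum>u\<in>V. \<Sum>x\<in>cover. if u \<in> star x then 1 / real (deg u) else 0)"
    by (rule sum.swap)
  also have "\<dots> = (\<Sum>u\<in>V. real (card {x \<in> cover. u \<in> star x}) / real (deg u))"
    by (intro sum.cong refl) (simp add: sum.If_cases Int_def)
  also have "\<dots> = (\<Sum>u\<in>V - cover. 1) + (\<Sum>u\<in>cover. real (j u) / real (deg u))"
  proof -
    have "(\<Sum>u\<in>V - cover. real (card {x \<in> cover. u \<in> star x}) / real (deg u)) = (\<Sum>u\<in>V - cover. 1)"
    proof (rule sum.cong[OF refl])
      fix u assume "u \<in> V - cover"
      then show "real (card {x \<in> cover. u \<in> star x}) / real (deg u) = 1"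
        using count[of u] deg_pos[OF n, of u] by simp
    qed
    moreover have "(\<Sum>u\<in>cover. real (card {x \<in> cover. u \<in> star x}) / real (deg u))
        = (\<Sum>u\<in>cover. real (j u) / real (deg u))"
      using count cover_subset by (intro sum.cong[OF refl]) auto
    ultimately show ?thesis by (simp only: sum.subset_diff[OF cover_subset finite_V])
  qed
  finally have 1: "(\<Sum>x\<in>cover. \<Sum>u\<in>star x. 1 / real (deg u))
    = real (card (V - cover)) + (\<Sum>u\<in>cover. real (j u) / real (deg u))" by simp
  \<comment> \<open>\<open>j x + 2\<close> equals \<open>deg x - excess x\<close>, plus 1 at the
    root. So a covered vertex also contributes 1, up to the excess and the root correction.\<close>
  have 2: "real (j x) / real (deg x) + 2 / real (deg x)
      = 1 - real (excess x) / real (deg x) + (if x = r then 1 / real (deg r) else 0)"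
    if x: "x \<in> cover" for x
    using deg[OF x] deg_pos[OF n, of x] x cover_subset
    by (auto simp: field_simps split: if_splits)
  have "(\<Sum>x\<in>cover. (\<Sum>u\<in>star x. 1 / real (deg u)) + 2 / real (deg x))
      = real (card (V - cover)) + (\<Sum>x\<in>cover. real (j x) / real (deg x) + 2 / real (deg x))"
    by (simp add: sum.distrib 1)
  also have "(\<Sum>x\<in>cover. real (j x) / real (deg x) + 2 / real (deg x))
     = (\<Sum>x\<in>cover. 1 - real (excess x) / real (deg x) + (if x = r then 1 / real (deg r) else 0))"
    using 2 by (intro sum.cong) auto
  also have "\<dots> = real (card cover) - (\<Sum>x\<in>cover. real (excess x) / real (deg x))
      + (if r \<in> cover then 1 / real (deg r) else 0)"
    by (simp add: sum.distrib sum_subtractf)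
  also have "real (card (V - cover)) = real (card V) - real (card cover)"
    using cover_subset finite_V by (simp add: card_Diff_subset card_mono of_nat_diff)
  finally show ?thesis by simp
qed

section \<open>Bounds on the sum of the star norms\<close>

definition cover_bound :: real where
  "cover_bound = (\<Sum>x\<in>cover. 2 * sqrt ((\<Sum>u\<in>star x. 1 / real (deg u)) / real (deg x)))"

lemma cover_bound_le:
  assumes n: "card V \<ge> 2"
  shows "cover_bound \<le> (real (card V) - (\<Sum>x\<in>cover. real (excess x) / real (deg x))
      + (if r \<in> cover then 1 / real (deg r) else 0)) / sqrt 2"
proof -
  have "2 * sqrt ((\<Sum>u\<in>star x. 1 / real (deg u)) / real (deg x))
      \<le> ((\<Sum>u\<in>star x. 1 / real (deg u)) + 2 / real (deg x)) / sqrt 2" for x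
  proof -
    define s where "s = (\<Sum>u\<in>star x. 1 / real (deg u))"
    have s: "s \<ge> 0" by (auto simp: s_def intro: sum_nonneg)
    \<comment> \<open>The factor 2 is inserted so that AM-GM produces the summand
      \<open>2 / deg x\<close> for which the star weights add up in
      \<open>star_weight_eq\<close>.\<close>
    have "2 * sqrt (s / real (deg x)) = 2 * sqrt (s * (2 / real (deg x))) / sqrt 2"
      by (simp add: real_sqrt_divide real_sqrt_mult)
    also have "\<dots> \<le> (s + 2 / real (deg x)) / sqrt 2"
      using arith_geo_mean_sqrt[of s "2 / real (deg x)"] s by (intro divide_right_mono) auto
    finally show ?thesis by (simp add: s_def)
  qed
  then show ?thesis
    unfolding star_weight_eq[OF n, symmetric] cover_bound_def sum_divide_distrib by (rule sum_mono)
qed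

lemma cover_bound_le_root_deg:
  assumes "card V \<ge> 2"
  shows "cover_bound \<le> (real (card V) + 1 / real (deg r)) / sqrt 2"
proof -
  have "0 \<le> (\<Sum>x\<in>cover. real (excess x) / real (deg x))" by (intro sum_nonneg) auto
  moreover have "(if r \<in> cover then 1 / real (deg r) else 0) \<le> 1 / real (deg r)" by simp
  ultimately have "real (card V) - (\<Sum>x\<in>cover. real (excess x) / real (deg x))
      + (if r \<in> cover then 1 / real (deg r) else 0) \<le> real (card V) + 1 / real (deg r)" by linarith
  then show ?thesis
    using cover_bound_le[OF assms] by (meson divide_right_mono order_trans real_sqrt_ge_zero zero_le_numeral)
qed

text \<open>
  If the root is in the cover, a vanishing excess would match the cover with its complement.  A positive
  excess at any vertex outweighs the correction at the root, because the root has maximal degree.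
\<close>

lemma cover_bound_le_odd:
  assumes n: "card V \<ge> 2" "odd (card V)" and max: "\<And>x. x \<in> V \<Longrightarrow> deg x \<le> deg r"
  shows "cover_bound \<le> real (card V) / sqrt 2"
proof -
  have "(if r \<in> cover then 1 / real (deg r) else 0) \<le> (\<Sum>x\<in>cover. real (excess x) / real (deg x))"
  proof (cases "r \<in> cover")
    case False
    then show ?thesis by (simp add: sum_nonneg)
  next
    case True
    have "(\<Sum>x\<in>cover. Suc (excess x)) = card V - card cover"
      using True cover_subset finite_V unfolding sum_excess
      by (simp add: card_Diff_subset)
    then have "(\<Sum>x\<in>cover. excess x) + card cover = card V - card cover"
      by (simp add: sum_Suc)
    then have "(\<Sum>x\<in>cover. excess x) \<noteq> 0"
      using n card_mono[OF finite_V cover_subset] by presburger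
    then obtain x where x: "x \<in> cover" "excess x \<noteq> 0" by (meson sum.neutral)
    have "x \<in> V" using x cover_subset by auto
    have "1 / real (deg r) \<le> 1 / real (deg x)"
      using max[OF \<open>x \<in> V\<close>] deg_pos[OF n(1) \<open>x \<in> V\<close>] by (intro divide_left_mono) auto
    also have "\<dots> \<le> real (excess x) / real (deg x)"
      using x by (intro divide_right_mono) auto
    also have "\<dots> \<le> (\<Sum>x\<in>cover. real (excess x) / real (deg x))"
      using x by (intro member_le_sum) auto
    finally show ?thesis using True by simp
  qed
  then have "real (card V) - (\<Sum>x\<in>cover. real (excess x) / real (deg x))
      + (if r \<in> cover then 1 / real (deg r) else 0) \<le> real (card V)" by linarith
  then show ?thesis
    using cover_bound_le[OF n(1)] by (meson divide_right_mono order_trans real_sqrt_ge_zero zero_le_numeral)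
qed

text \<open>The root is adjacent to every other vertex, so the cover is \<open>{r}\<close>. The only
  dyad has weights 1 at \<open>deg r\<close> leaves, divided by \<open>deg r\<close>, and so
  contributes 2.\<close>

lemma cover_bound_eq_star:
  assumes n: "card V \<ge> 2" and root: "deg r = card V - 1"
  shows "cover_bound = 2"
proof -
  have "card (children r) = card (V - {r})" using root root_in by (simp add: deg_eq)
  then have ch: "children r = V - {r}"
    using finite_V by (intro card_subset_eq) (auto simp: children_def)
  have ch0: "children x = {}" if "x \<noteq> r" for x
    using ch that by (auto simp: children_def)
  have "x \<notin> cover" if "x \<noteq> r" for x
    using cover_iff[of x] ch0[OF that] by simp
  moreover have "r \<in> cover"
    using children_root_nonempty[OF n] calculation ch by (subst cover_iff) blast
  ultimately have cov: "cover = {r}" by auto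
  have "star r = V - {r}" by (auto simp: star_def cov ch up_def)
  moreover have "deg u = 1" if "u \<in> V - {r}" for u
    using that ch0[of u] by (simp add: deg_eq)
  ultimately have "(\<Sum>u\<in>star r. 1 / real (deg u)) = real (deg r)"
    using root root_in by simp
  moreover have "deg r > 0" using root n by simp
  ultimately show ?thesis by (simp add: cover_bound_def cov)
qed

text \<open>If all degrees were at most 1, the degree sum \<open>2 * (card V - 1)\<close> would not
  exceed \<open>card V\<close>.\<close>

lemma deg_root_ge_2:
  assumes "card V \<ge> 3" and max: "\<And>x. x \<in> V \<Longrightarrow> deg x \<le> deg r"
  shows "deg r \<ge> 2"
proof (rule ccontr)
  assume "\<not> deg r \<ge> 2"
  then have "card V * deg r \<le> card V * 1" by (intro mult_le_mono2) simp
  moreover have "2 * (card V - 1) \<le> card V * deg r"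
    using sum_bounded_above[of V deg "deg r"] max by (simp add: sum_deg)
  ultimately show False using assms(1) by linarith
qed

text \<open>Since each edge is charged exactly once, the stars of the covered vertices decompose the
  matrix into dyads, and \<open>matrix_energy_dyadic_le\<close> applies.\<close>

lemma matrix_energy_le_cover_bound:
  assumes vs: "distinct vs" "set vs = V"
  shows "matrix_energy (mat (length vs) (length vs) (\<lambda>(i, j).
    if (vs ! i, vs ! j) \<in> E then 1 / sqrt (real (deg (vs ! i)) * real (deg (vs ! j))) else 0))
    \<le> cover_bound" (is "matrix_energy ?A \<le> _")
proof -
  define m where "m = length vs"
  \<comment> \<open>\<open>a x\<close> is the unit vector of \<open>x\<close>; \<open>b x\<close> is
    row \<open>x\<close> of the matrix restricted to the star of \<open>x\<close>.\<close>
  define a where "a x = vec m (\<lambda>i. if vs ! i = x then 1 else 0 :: real)" for x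
  define b where "b x = vec m (\<lambda>i. if vs ! i \<in> star x
    then 1 / sqrt (real (deg x) * real (deg (vs ! i))) else 0)" for x
  have sumV: "(\<Sum>i = 0..<m. f (vs ! i)) = (\<Sum>u\<in>V. f u)" for f :: "'a \<Rightarrow> real"
    using vs by (intro sum.reindex_bij_betw bij_betw_nth) (auto simp: m_def)
  have in_V: "vs ! i \<in> V" if "i < m" for i using vs that by (auto simp: m_def)
  have eq: "?A $$ (i, j) = (\<Sum>x\<in>cover. a x $ i * b x $ j + b x $ i * a x $ j)"
    if ij: "i < m" "j < m" for i j
  proof -
    let ?u = "vs ! i" and ?v = "vs ! j"
    let ?w = "1 / sqrt (real (deg ?u) * real (deg ?v))"
    have "(\<Sum>x\<in>cover. a x $ i * b x $ j + b x $ i * a x $ j)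
        = (\<Sum>x\<in>cover. (if ?u = x then (if ?v \<in> star ?u then ?w else 0) else 0)
          + (if ?v = x then (if ?u \<in> star ?v then ?w else 0) else 0))"
      using ij by (intro sum.cong refl) (auto simp: a_def b_def mult.commute)
    also have "\<dots> = (if ?u \<in> cover \<and> ?v \<in> star ?u then ?w else 0)
        + (if ?v \<in> cover \<and> ?u \<in> star ?v then ?w else 0)"
      by (simp add: sum.distrib)
    also have "\<dots> = ?A $$ (i, j)"
      using ij star_asym[of ?u ?v] by (auto simp: m_def edge_iff_star)
    finally show ?thesis by simp
  qed
  have norm_a: "a x \<bullet> a x = 1" if x: "x \<in> cover" for x
  proof -
    have "a x \<bullet> a x = (\<Sum>i = 0..<m. if vs ! i = x then 1 else 0)"
      unfolding scalar_prod_def by (rule sum.cong) (auto simp: a_def)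
    also have "\<dots> = (\<Sum>u\<in>V. if u = x then 1 else 0)" by (rule sumV)
    also have "\<dots> = 1" using x cover_subset finite_V by (auto simp: subset_iff)
    finally show ?thesis .
  qed
  have norm_b: "b x \<bullet> b x = (\<Sum>u\<in>star x. 1 / real (deg u)) / real (deg x)" if x: "x \<in> cover" for x
  proof -
    have "b x \<bullet> b x = (\<Sum>i = 0..<m. if vs ! i \<in> star x
        then 1 / (real (deg x) * real (deg (vs ! i))) else 0)"
      unfolding scalar_prod_def by (rule sum.cong) (auto simp: b_def)
    also have "\<dots> = (\<Sum>u\<in>V. if u \<in> star x then 1 / (real (deg x) * real (deg u)) else 0)"
      by (rule sumV)
    also have "\<dots> = (\<Sum>u\<in>star x. 1 / (real (deg x) * real (deg u)))"
      using x cover_subset by (intro sum_star) auto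
    finally show ?thesis by (simp add: sum_divide_distrib mult.commute)
  qed
  have "matrix_energy ?A \<le> (\<Sum>x\<in>cover. 2 * (sqrt (a x \<bullet> a x) * sqrt (b x \<bullet> b x)))"
    by (rule matrix_energy_dyadic_le[OF _ _ _ eq]) (simp_all add: m_def a_def b_def)
  also have "\<dots> = cover_bound"
    unfolding cover_bound_def by (intro sum.cong refl) (simp add: norm_a norm_b)
  finally show ?thesis .
qed

end

section \<open>Rooting an undirected tree\<close>

context pair_graph
begin

lemma pawalk_verts_snoc:
  "pcas x p y \<Longrightarrow> pawalk_verts x (p @ [(y, u)]) = pawalk_verts x p @ [u]"
  by (induction p arbitrary: x) auto

text \<open>The invariant for growing a tree from \<open>r\<close>. Paths staying inside
  \<open>S\<close> are recorded because they avoid a new vertex and can be closed to a cycle through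
  it.\<close>

definition rooted_subtree :: "'a \<Rightarrow> 'a set \<Rightarrow> bool" where
  "rooted_subtree r S \<longleftrightarrow> S \<subseteq> pverts G \<and>
     (\<exists>par dep. rooted_tree S (parcs G \<inter> S \<times> S) r par dep) \<and>
     (\<forall>x\<in>S. \<forall>y\<in>S. \<exists>p. apath x p y \<and> set (pawalk_verts x p) \<subseteq> S)"

lemma rooted_subtree_singleton: "r \<in> pverts G \<Longrightarrow> rooted_subtree r {r}"
  unfolding rooted_subtree_def rooted_tree_def
  by (auto dest: no_loops' intro!: exI[of _ "[]"] simp: apath_Nil_iff)

text \<open>
  A new vertex adjacent to two vertices of the subtree would close a cycle with the path between them.
\<close>

lemma rooted_subtree_extend:
  assumes S: "rooted_subtree r S" and ne: "S \<noteq> pverts G"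
    and conn: "Digraph_Component.connected (with_proj G)"
    and acyclic: "\<not> (\<exists>p. cycle p \<and> 3 \<le> length p)"
  shows "\<exists>u. u \<notin> S \<and> rooted_subtree r (insert u S)"
proof -
  obtain par dep where rt: "rooted_tree S (parcs G \<inter> S \<times> S) r par dep"
    using S by (auto simp: rooted_subtree_def)
  interpret R: rooted_tree S "parcs G \<inter> S \<times> S" r par dep by (rule rt)
  have SV: "S \<subseteq> pverts G" using S by (simp add: rooted_subtree_def)
  have path: "\<exists>p. apath x p y \<and> set (pawalk_verts x p) \<subseteq> S" if "x \<in> S" "y \<in> S" for x y
    using S that by (auto simp: rooted_subtree_def)
  have sym: "(a, b) \<in> parcs G \<longleftrightarrow> (b, a) \<in> parcs G" for a b
    using pair_sym_arcs unfolding symmetric_def by (auto dest: symD)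
  \<comment> \<open>Otherwise \<open>S\<close> would be closed under arcs and contain everything
    reachable from \<open>r\<close>, that is, all vertices.\<close>
  have "\<exists>w\<in>S. \<exists>u. u \<notin> S \<and> (w, u) \<in> parcs G"
  proof (rule ccontr)
    assume no: "\<not> ?thesis"
    have "v \<in> S" if "r \<rightarrow>\<^sup>*\<^bsub>G\<^esub> v" for v
      using that
    proof (induction rule: reachable_induct)
      case base
      show ?case by (rule R.root_in)
    next
      case (step x y)
      then show ?case using no by auto
    qed
    moreover have "strongly_connected (with_proj G)"
      using symmetric_connected_imp_strongly_connected[OF pair_sym_arcs conn] .
    ultimately have "pverts G \<subseteq> S"
      using R.root_in SV by (auto simp: strongly_connected_def)
    then show False using ne SV by auto
  qed
  then obtain w u where w: "w \<in> S" and u: "u \<notin> S" and wu: "(w, u) \<in> parcs G" by blast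
  have uV: "u \<in> pverts G" and uw: "(u, w) \<in> parcs G" using wu sym in_arcsD2 by auto
  have unique: "w' = w" if w': "w' \<in> S" "(w', u) \<in> parcs G" for w'
  proof (rule ccontr)
    assume neq: "w' \<noteq> w"
    obtain p where p: "apath w p w'" "set (pawalk_verts w p) \<subseteq> S"
      using path[OF w w'(1)] by auto
    then have aw: "awalk w p w'" "pcas w p w'" "distinct (pawalk_verts w p)"
      by (auto simp: apath_def awalk_def)
    \<comment> \<open>The ends differ, so \<open>p\<close> has an arc and the closed walk has length
      at least 3, unlike the back-and-forth walk along one edge.\<close>
    have "p \<noteq> []" using aw neq by auto
    have "cycle ((u, w) # p @ [(w', u)])"
      unfolding cycle_def
    proof (intro exI[of _ u] conjI)
      show "awalk u ((u, w) # p @ [(w', u)]) u"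
        using aw uw w' uV by (auto simp: awalk_simps)
      show "distinct (tl (pawalk_verts u ((u, w) # p @ [(w', u)])))"
        using aw p u by (auto simp: pawalk_verts_snoc)
    qed simp
    moreover have "3 \<le> length ((u, w) # p @ [(w', u)])"
      using \<open>p \<noteq> []\<close> by (cases p) auto
    ultimately show False using acyclic by blast
  qed
  have path_from_u: "\<exists>p. apath u p y \<and> set (pawalk_verts u p) \<subseteq> insert u S" if y: "y \<in> S" for y
  proof -
    obtain p where p: "apath w p y" "set (pawalk_verts w p) \<subseteq> S" using path[OF w y] by auto
    then show ?thesis using uw u by (intro exI[of _ "(u, w) # p"]) (auto simp: apath_Cons_iff)
  qed
  have path_to_u: "\<exists>p. apath x p u \<and> set (pawalk_verts x p) \<subseteq> insert u S" if x: "x \<in> S" for x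
  proof -
    obtain p where p: "apath x p w" "set (pawalk_verts x p) \<subseteq> S" using path[OF x w] by auto
    then have "pcas x p w" by (auto simp: apath_def awalk_def)
    then show ?thesis using wu u p uV
      by (intro exI[of _ "p @ [(w, u)]"]) (auto simp: apath_def awalk_simps pawalk_verts_snoc)
  qed
  have path_refl: "\<exists>p. apath u p u \<and> set (pawalk_verts u p) \<subseteq> insert u S"
    using uV by (intro exI[of _ "[]"]) (simp add: apath_Nil_iff)
  \<comment> \<open>\<open>u\<close> becomes a child of \<open>w\<close>; by \<open>unique\<close>
    this is its only edge into \<open>S\<close>.\<close>
  have "rooted_tree (insert u S) (parcs G \<inter> insert u S \<times> insert u S) r
      (par(u := w)) (dep(u := Suc (dep w)))"
  proof
    fix a b
    have "a \<in> S \<Longrightarrow> a \<noteq> r \<Longrightarrow> par a \<noteq> u" for a using R.par_in u by auto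
    moreover have "(a, b) \<in> parcs G \<longleftrightarrow> (a \<noteq> r \<and> b = par a) \<or> (b \<noteq> r \<and> a = par b)"
      if "a \<in> S" "b \<in> S" using R.edge_iff[of a b] that by auto
    moreover have "u \<noteq> r" using u R.root_in by auto
    ultimately show "(a, b) \<in> parcs G \<inter> insert u S \<times> insert u S \<longleftrightarrow>
        (a \<in> insert u S \<and> a \<noteq> r \<and> b = (par(u := w)) a) \<or>
        (b \<in> insert u S \<and> b \<noteq> r \<and> a = (par(u := w)) b)"
      using unique[of a] unique[of b] uw wu u w sym[of a b] R.par_in[of a] R.par_in[of b] no_loops'[of u u]
      by (cases "a = u"; cases "b = u") auto
  qed (use R.finite_V R.root_in R.par_in R.dep_par u w in \<open>auto\<close>)
  moreover have "\<exists>p. apath x p y \<and> set (pawalk_verts x p) \<subseteq> insert u S"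
    if "x \<in> insert u S" "y \<in> insert u S" for x y
    using that path[of x y] path_from_u[of y] path_to_u[of x] path_refl by blast
  ultimately show ?thesis
    using u uV SV unfolding rooted_subtree_def by blast
qed

text \<open>Vertices are added one at a time until the cardinality forces all of them. The root is
  free, which allows one of maximal degree.\<close>

lemma rooted_tree_exists:
  assumes r: "r \<in> pverts G"
    and conn: "Digraph_Component.connected (with_proj G)"
    and acyclic: "\<not> (\<exists>p. cycle p \<and> 3 \<le> length p)"
  shows "\<exists>par dep. rooted_tree (pverts G) (parcs G) r par dep"
proof -
  have "\<exists>S. rooted_subtree r S \<and> card S = Suc k" if "Suc k \<le> card (pverts G)" for k
    using that
  proof (induction k)
    case 0
    show ?case using rooted_subtree_singleton[OF r] by (intro exI[of _ "{r}"]) simp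
  next
    case (Suc k)
    then obtain S where S: "rooted_subtree r S" "card S = Suc k" by auto
    then have "S \<noteq> pverts G" using Suc.prems by auto
    then obtain u where u: "u \<notin> S" "rooted_subtree r (insert u S)"
      using rooted_subtree_extend[OF S(1) _ conn acyclic] by auto
    moreover have "finite S" using S(2) by (intro card_ge_0_finite) simp
    ultimately show ?case using S(2) by (intro exI[of _ "insert u S"]) simp
  qed
  moreover obtain k where k: "card (pverts G) = Suc k"
    using r pair_finite_verts by (metis card_gt_0_iff empty_iff gr0_implies_Suc)
  ultimately obtain S where S: "rooted_subtree r S" "card S = card (pverts G)" by auto
  then have "S = pverts G"
    using pair_finite_verts by (intro card_subset_eq) (auto simp: rooted_subtree_def)
  moreover have "parcs G \<inter> pverts G \<times> pverts G = parcs G" using in_arcsD1 in_arcsD2 by auto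
  ultimately show ?thesis using S(1) by (auto simp: rooted_subtree_def)
qed

end

section \<open>Numerical estimates\<close>

lemma sqrt_2_le: "sqrt 2 \<le> (283 / 200)"
  by (rule real_le_lsqrt) (simp_all add: power2_eq_square)

lemma sqrt_2_ge: "(707 / 500) \<le> sqrt 2"
  by (rule real_le_rsqrt) (simp add: power2_eq_square)

lemma even_bound:
  fixes n :: real
  assumes "n \<ge> 4"
  shows "(n + 1 / 2) / sqrt 2 \<le> sqrt ((n - 2) * ((5 * n - 10) / 9)) + 2"
proof -
  have "(n + 1 / 2) / sqrt 2 - 2 = (n + 1 / 2) * sqrt 2 / 2 - 2"
    by (simp add: field_simps)
  also have "\<dots> \<le> (n + 1 / 2) * (283 / 200) / 2 - 2"
    using sqrt_2_le sqrt_2_ge assms by (intro diff_right_mono divide_right_mono mult_left_mono) auto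
  \<comment> \<open>\<open>149 / 200\<close> is a rational just below \<open>sqrt 5 / 3\<close>, the
    slope of the target.\<close>
  also have "\<dots> \<le> (149 / 200) * (n - 2)" using assms by simp
  also have "\<dots> \<le> sqrt ((n - 2) * ((5 * n - 10) / 9))"
  proof (rule real_le_rsqrt)
    have "(n - 2) * ((5 * n - 10) / 9) = 5 / 9 * (n - 2)\<^sup>2" by (simp add: power2_eq_square field_simps)
    moreover have "(149 / 200)\<^sup>2 * (n - 2)\<^sup>2 \<le> 5 / 9 * (n - 2)\<^sup>2"
      by (intro mult_right_mono) (simp_all add: power2_eq_square)
    ultimately show "((149 / 200) * (n - 2))\<^sup>2 \<le> (n - 2) * ((5 * n - 10) / 9)"
      by (simp only: power_mult_distrib)
  qed
  finally show ?thesis by simp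
qed

lemma odd_bound:
  fixes n :: real
  assumes "n \<ge> 5"
  shows "n / sqrt 2 \<le> sqrt ((n - 3) * ((5 * n - 10) / 9)) + 2"
proof -
  have "n / sqrt 2 - 2 = n * sqrt 2 / 2 - 2" by (simp add: field_simps)
  also have "\<dots> \<le> sqrt ((n - 3) * ((5 * n - 10) / 9))"
  proof (rule real_le_rsqrt)
    \<comment> \<open>After squaring, \<open>sqrt 2\<close> occurs only with a negative sign, so its
      lower bound is used. The gap between 1/2 and 5/9 absorbs the rest.\<close>
    have "(n * sqrt 2 / 2 - 2)\<^sup>2 = n\<^sup>2 / 2 - 2 * n * sqrt 2 + 4"
      by (simp add: power2_eq_square field_simps)
    also have "\<dots> \<le> n\<^sup>2 / 2 - 2 * n * (707 / 500) + 4"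
      using sqrt_2_le sqrt_2_ge assms by (intro add_right_mono diff_left_mono mult_left_mono) auto
    also have "\<dots> \<le> (n - 3) * ((5 * n - 10) / 9)"
    proof -
      have "5 * n \<le> n\<^sup>2" using assms by (simp add: power2_eq_square)
      moreover have "(n - 3) * ((5 * n - 10) / 9) = (5 * n\<^sup>2 - 25 * n + 30) / 9"
        by (simp add: power2_eq_square field_simps)
      ultimately show ?thesis using assms by (simp add: field_simps)
    qed
    finally show "(n * sqrt 2 / 2 - 2)\<^sup>2 \<le> (n - 3) * ((5 * n - 10) / 9)" .
  qed
  finally show ?thesis by simp
qed

lemma even_bound_large:
  fixes n :: real
  assumes "n \<ge> 103"
  shows "(n + 1 / 2) / sqrt 2 \<le> sqrt ((n - 2) * ((15 * n - 57) / 28)) + 2"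
proof -
  have "(n + 1 / 2) / sqrt 2 - 2 = (n + 1 / 2) * sqrt 2 / 2 - 2"
    by (simp add: field_simps)
  also have "\<dots> \<le> (n + 1 / 2) * (283 / 200) / 2 - 2"
    using sqrt_2_le sqrt_2_ge assms by (intro diff_right_mono divide_right_mono mult_left_mono) auto
  also have "\<dots> \<le> (283 / 400) * n - (8 / 5)" by (simp add: field_simps)
  also have "\<dots> \<le> sqrt ((n - 2) * ((15 * n - 57) / 28))"
  proof (rule real_le_rsqrt)
    \<comment> \<open>\<open>(283 / 400)^2\<close> is below \<open>15 / 28\<close>. This inequality
      turns the quadratic surplus into a linear one that outweighs the linear defect.\<close>
    have "103 * n \<le> n\<^sup>2" using assms by (simp add: power2_eq_square)
    moreover have "(n - 2) * ((15 * n - 57) / 28) = (15 * n\<^sup>2 - 87 * n + 114) / 28"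
      by (simp add: power2_eq_square field_simps)
    moreover have "((283 / 400) * n - (8 / 5))\<^sup>2 = (80089 / 160000) * n\<^sup>2 - (283 / 125) * n + (64 / 25)"
      by (simp add: power2_eq_square field_simps)
    ultimately show "((283 / 400) * n - (8 / 5))\<^sup>2 \<le> (n - 2) * ((15 * n - 57) / 28)"
      using assms by (simp add: field_simps)
  qed
  finally show ?thesis by simp
qed

lemma odd_bound_large:
  fixes n :: real
  assumes "n \<ge> 103"
  shows "n / sqrt 2 \<le> sqrt ((n - 3) * ((15 * n - 57) / 28)) + 2"
proof -
  have "n / sqrt 2 - 2 = n * sqrt 2 / 2 - 2" by (simp add: field_simps)
  also have "\<dots> \<le> n * (283 / 200) / 2 - 2"
    using sqrt_2_le sqrt_2_ge assms by (intro diff_right_mono divide_right_mono mult_left_mono) auto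
  also have "\<dots> \<le> sqrt ((n - 3) * ((15 * n - 57) / 28))"
  proof (rule real_le_rsqrt)
    have "103 * n \<le> n\<^sup>2" using assms by (simp add: power2_eq_square)
    moreover have "(n - 3) * ((15 * n - 57) / 28) = (15 * n\<^sup>2 - 102 * n + 171) / 28"
      by (simp add: power2_eq_square field_simps)
    moreover have "(n * (283 / 200) / 2 - 2)\<^sup>2 = (80089 / 160000) * n\<^sup>2 - (283 / 100) * n + 4"
      by (simp add: power2_eq_square field_simps)
    ultimately show "(n * (283 / 200) / 2 - 2)\<^sup>2 \<le> (n - 3) * ((15 * n - 57) / 28)"
      using assms by (simp add: field_simps)
  qed
  finally show ?thesis by simp
qed

section \<open>The Randic energy of a tree\<close>

lemma out_degree_eq: "out_degree (with_proj G) u = card {v. (u, v) \<in> parcs G}"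
proof -
  have "out_arcs (with_proj G) u = Pair u ` {v. (u, v) \<in> parcs G}"
    by (auto simp: out_arcs_def)
  then show ?thesis by (simp add: out_degree_def card_image inj_on_def)
qed

lemma (in rooted_tree) randic_energy_le_cover_bound:
  assumes "pverts T = V" "parcs T = E"
  shows "randic_energy T \<le> cover_bound"
proof -
  obtain vs where vs: "distinct vs" "set vs = V"
    using finite_distinct_list[OF finite_V] by auto
  have "randic_energy T = matrix_energy (randic_matrix T vs)"
    using vs assms by (intro randic_energy_eq) auto
  also have "randic_matrix T vs = mat (length vs) (length vs) (\<lambda>(i, j).
    if (vs ! i, vs ! j) \<in> E then 1 / sqrt (real (deg (vs ! i)) * real (deg (vs ! j))) else 0)"
    unfolding randic_matrix_def randic_entry_def out_degree_eq deg_def assms(2) ..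
  also have "matrix_energy \<dots> \<le> cover_bound"
    by (rule matrix_energy_le_cover_bound[OF vs])
  finally show ?thesis .
qed

text \<open>The tree is rooted at a vertex of maximal degree. For \<open>n \<ge> 4\<close> this
  makes the root correction at most 1/2, for odd \<open>n\<close> it cancels, and for
  \<open>n \<le> 3\<close> the root is the centre of a star.\<close>

lemma undirected_tree_randic_energy_le:
  assumes T: "undirected_tree T" and n: "card (pverts T) = n" "n \<ge> 2"
  shows "n \<ge> 4 \<Longrightarrow> randic_energy T \<le> (real n + 1 / 2) / sqrt 2"
    and "odd n \<Longrightarrow> randic_energy T \<le> real n / sqrt 2"
    and "n \<le> 3 \<Longrightarrow> randic_energy T \<le> 2"
proof -
  interpret G: pair_graph T using T by (simp add: undirected_tree_def)
  \<comment> \<open>The degree is named before rooting, because the choice of the root depends on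
    it.\<close>
  define d where "d x = card {u. (x, u) \<in> parcs T}" for x
  have "Max (d ` pverts T) \<in> d ` pverts T"
    using n G.pair_finite_verts by (intro Max_in) auto
  then obtain r where r: "r \<in> pverts T" "d r = Max (d ` pverts T)" by auto
  have max: "d x \<le> d r" if "x \<in> pverts T" for x
    using that G.pair_finite_verts by (simp add: r(2))
  obtain par dep where "rooted_tree (pverts T) (parcs T) r par dep"
    using G.rooted_tree_exists[OF r(1)] T by (auto simp: undirected_tree_def)
  then interpret R: rooted_tree "pverts T" "parcs T" r par dep .
  have card: "card (pverts T) \<ge> 2" using n by simp
  have max': "R.deg x \<le> R.deg r" if "x \<in> pverts T" for x
    using max[OF that] by (simp add: R.deg_def d_def)
  have bound: "randic_energy T \<le> R.cover_bound"
    using R.randic_energy_le_cover_bound[OF refl refl] .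
  show "randic_energy T \<le> (real n + 1 / 2) / sqrt 2" if "n \<ge> 4"
  proof -
    have "R.deg r \<ge> 2" using that n max' by (intro R.deg_root_ge_2) auto
    then have "1 / real (R.deg r) \<le> 1 / 2" by (intro divide_left_mono) auto
    then have "(real n + 1 / real (R.deg r)) / sqrt 2 \<le> (real n + 1 / 2) / sqrt 2"
      by (intro divide_right_mono) auto
    then show ?thesis using bound R.cover_bound_le_root_deg[OF card] n by simp
  qed
  show "randic_energy T \<le> real n / sqrt 2" if "odd n"
    using bound R.cover_bound_le_odd[OF card _ max'] that n by simp
  show "randic_energy T \<le> 2" if "n \<le> 3"
  proof -
    have "R.deg r \<ge> n - 1"
    proof (cases "n = 3")
      case True
      then have "R.deg r \<ge> 2" using n max' by (intro R.deg_root_ge_2) auto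
      with True show ?thesis by simp
    next
      case False
      then show ?thesis using that n R.deg_pos[OF card r(1)] by simp
    qed
    moreover have "R.deg r \<le> n - 1"
    proof -
      have "{u. (r, u) \<in> parcs T} \<subseteq> pverts T - {r}"
        using G.in_arcsD2 G.no_loops' by auto
      then have "R.deg r \<le> card (pverts T - {r})"
        unfolding R.deg_def using G.pair_finite_verts by (intro card_mono) auto
      then show ?thesis using r n by simp
    qed
    ultimately have "R.deg r = card (pverts T) - 1" using n by simp
    then show ?thesis using bound R.cover_bound_eq_star[OF card] by simp
  qed
qed

theorem corollary4p3:
  fixes T :: "'a pair_pre_digraph" and n :: nat
  assumes "undirected_tree T" and "card (pverts T) = n"
  shows
    "(n \<ge> 2 \<and> even n \<longrightarrow>
        randic_energy T \<le> sqrt ((real n - 2) * ((5 * real n - 10) / 9)) + 2) \<and>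
     (n \<ge> 2 \<and> odd n \<longrightarrow>
        randic_energy T \<le> sqrt ((real n - 3) * ((5 * real n - 10) / 9)) + 2) \<and>
     (n \<ge> 103 \<and> even n \<longrightarrow>
        randic_energy T \<le> sqrt ((real n - 2) * ((15 * real n - 57) / 28)) + 2) \<and>
     (n \<ge> 103 \<and> odd n \<longrightarrow>
        randic_energy T \<le> sqrt ((real n - 3) * ((15 * real n - 57) / 28)) + 2)"
proof (intro conjI impI; elim conjE)
  assume n: "n \<ge> 2" "even n"
  show "randic_energy T \<le> sqrt ((real n - 2) * ((5 * real n - 10) / 9)) + 2"
  proof (cases "n \<ge> 4")
    case True
    then show ?thesis
      by (intro order_trans[OF undirected_tree_randic_energy_le(1)[OF assms n(1)] even_bound]) auto
  next
    case False
    \<comment> \<open>The square root vanishes at \<open>n = 2\<close>, leaving exactly the star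
      bound 2.\<close>
    with n have "n = 2" by presburger
    with undirected_tree_randic_energy_le(3)[OF assms n(1)] show ?thesis by simp
  qed
next
  assume n: "n \<ge> 2" "odd n"
  show "randic_energy T \<le> sqrt ((real n - 3) * ((5 * real n - 10) / 9)) + 2"
  proof (cases "n \<ge> 5")
    case True
    then show ?thesis
      by (intro order_trans[OF undirected_tree_randic_energy_le(2)[OF assms n] odd_bound]) auto
  next
    case False
    \<comment> \<open>The factor \<open>n - 3\<close> vanishes and the right side is 2, below
      \<open>3 / sqrt 2\<close>, so the star bound is used instead.\<close>
    with n have "n = 3" by presburger
    with undirected_tree_randic_energy_le(3)[OF assms n(1)] show ?thesis by simp
  qed
next
  assume "n \<ge> 103"
  then show "randic_energy T \<le> sqrt ((real n - 2) * ((15 * real n - 57) / 28)) + 2"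
    by (intro order_trans[OF undirected_tree_randic_energy_le(1)[OF assms] even_bound_large]) auto
next
  assume "n \<ge> 103" "odd n"
  then show "randic_energy T \<le> sqrt ((real n - 3) * ((15 * real n - 57) / 28)) + 2"
    by (intro order_trans[OF undirected_tree_randic_energy_le(2)[OF assms] odd_bound_large]) auto
qed

end
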